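(* For every integer $n\ge2$ there exists $\varepsilon>0$ such that $$\Gamma_{\mathrm{real}}\Big(\underbrace{\tfrac1{1+\varepsilon}\,2\arctan\tfrac1{n-1},\ \dots,\ \tfrac1{1+\varepsilon}\,2\arctan\tfrac1{n-1}}_{n\text{ terms}}\Big)=+\infty.$$
   Context: For formal noncommuting variables $X_1,\dots,X_n$, $\Gamma(X_1,\dots,X_n)$ is the formal noncommutative power series of $\log\big((\exp X_1)\cdots(\exp X_n)\big)$ (the $n$-variable Baker–Campbell–Hausdorff series) with the coefficient of each monomial replaced by its absolute value. For $x_i\in[0,\infty)$, $\Gamma_{\mathrm{real}}(x_1,\dots,x_n)\in[0,+\infty]$ is the value of this series with $x_i$ substituted for $X_i$. *)

theory Defs
  imports "HOL-Analysis.Analysis"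
begin

text \<open>
  A formal power series in noncommuting variables indexed by \<open>'v\<close> is represented by its
  coefficient function: monomials are words, i.e. lists of variable indices.
\<close>

type_synonym 'v ncps = "'v list \<Rightarrow> real"

definition nc_var :: "'v \<Rightarrow> 'v ncps" where
  "nc_var i = (\<lambda>w. if w = [i] then 1 else 0)"

definition nc_one :: "'v ncps" where
  "nc_one = (\<lambda>w. if w = [] then 1 else 0)"

definition nc_mult :: "'v ncps \<Rightarrow> 'v ncps \<Rightarrow> 'v ncps" where
  "nc_mult f g = (\<lambda>w. \<Sum>k\<le>length w. f (take k w) * g (drop k w))"

primrec nc_power :: "'v ncps \<Rightarrow> nat \<Rightarrow> 'v ncps" where
  "nc_power f 0 = nc_one"
| "nc_power f (Suc k) = nc_mult f (nc_power f k)"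

text \<open>
  The two series below are coefficientwise sums. They are meant for arguments with constant
  term 0 (exponential) and 1 (logarithm); then each coefficient is a finite sum, see
  \<open>nc_exp_finite\<close> and \<open>nc_log_finite\<close>.
\<close>

definition nc_exp :: "'v ncps \<Rightarrow> 'v ncps" where
  "nc_exp f = (\<lambda>w. \<Sum>k. nc_power f k w / fact k)"

definition nc_log :: "'v ncps \<Rightarrow> 'v ncps" where
  "nc_log f = (\<lambda>w. \<Sum>k. (-1) ^ k / real (Suc k) * nc_power (\<lambda>v. f v - nc_one v) (Suc k) w)"

lemma nc_power_eq_0:
  assumes "f [] = 0" "length w < k"
  shows "nc_power f k w = 0"
  using assms(2)
proof (induction k arbitrary: w)
  case 0
  then show ?case by simp
next
  case (Suc k)
  have "f (take j w) * nc_power f k (drop j w) = 0" if "j \<le> length w" for j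
  proof (cases "j = 0")
    case True
    then show ?thesis using assms(1) by simp
  next
    case False
    then have "length (drop j w) < k" using Suc.prems that by simp
    then show ?thesis using Suc.IH by simp
  qed
  then show ?case unfolding nc_power.simps nc_mult_def by (intro sum.neutral) simp
qed

lemma nc_exp_finite:
  assumes "f [] = 0"
  shows "nc_exp f w = (\<Sum>k\<le>length w. nc_power f k w / fact k)"
  unfolding nc_exp_def
  by (rule suminf_finite) (use assms nc_power_eq_0[of f w] in auto)

lemma nc_log_finite:
  assumes "f [] = 1"
  shows "nc_log f w =
    (\<Sum>k<length w. (-1) ^ k / real (Suc k) * nc_power (\<lambda>v. f v - nc_one v) (Suc k) w)"
  unfolding nc_log_def
proof (rule suminf_finite)
  fix k assume "k \<notin> {..<length w}"
  then have "length w < Suc k" by simp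
  then have "nc_power (\<lambda>v. f v - nc_one v) (Suc k) w = 0"
    using assms by (intro nc_power_eq_0) (simp_all add: nc_one_def)
  then show "(-1) ^ k / real (Suc k) * nc_power (\<lambda>v. f v - nc_one v) (Suc k) w = 0" by simp
qed simp

text \<open>
  The \<open>n\<close> variables are indexed by \<open>0, \<dots>, n - 1\<close>.
\<close>

definition bch :: "nat \<Rightarrow> nat ncps" where
  "bch n = nc_log (foldr nc_mult (map (\<lambda>i. nc_exp (nc_var i)) [0..<n]) nc_one)"

definition Gamma_bch :: "nat \<Rightarrow> nat ncps" where
  "Gamma_bch n = (\<lambda>w. \<bar>bch n w\<bar>)"

text \<open>
  The value of \<open>Gamma_bch n\<close> at nonnegative reals \<open>xs ! 0, \<dots>, xs ! (n - 1)\<close>, where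
  \<open>n = length xs\<close>. All terms are nonnegative, so the sum over words always exists in
  \<open>[0, \<infinity>]\<close> and does not depend on an ordering of the words.
\<close>

definition Gamma_real :: "real list \<Rightarrow> ennreal" where
  "Gamma_real xs =
    (\<Sum>\<^sub>\<infinity>w\<in>lists {..<length xs}.
      ennreal (Gamma_bch (length xs) w * prod_list (map (\<lambda>i. xs ! i) w)))"

end

theory Submission
  imports Defs
begin

text \<open>
  Since $1/(k+1) = \int_0^1 t^k\,dt$, the coefficient of a word in the logarithm is the integral
  over $t \in [0,1]$ of its coefficient in the resolvent series $\sum_k (-t)^k (P-1)^{k+1}$, where
  $P$ is the product of the exponentials. For a word $a_1^{k_1} \cdots a_M^{k_M}$ with
  $a_i \neq a_{i+1}$ the resolvent coefficient factorises: every ascent $a_i < a_{i+1}$ contributes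
  $1-t$, every descent $-t$, and every run $G_{k_i}(t)$, where
  $\sum_k G_k(t) z^k = (e^z-1)/(1+t(e^z-1))$.

  If every run length is used an even number of times, then the integrand has constant sign, so
  there is no cancellation in the integral. This restriction costs only a constant factor: if all
  run lengths are at most $K$, there are $2^K$ parity types, and the Cauchy--Schwarz inequality
  applies to pairs of sequences of the same type. By the AM-GM inequality, exchanging ascents with
  descents, the letters contribute at least $((n-1)\sqrt{t(1-t)})^M$. Hence the series diverges at
  $x$ as soon as $(n-1)\sqrt{t(1-t)} \sum_{k\le K} |G_k(t)| x^k > 1$ for $t$ in some interval.

  For $T = 1/(n-1)$ and $x = 2 \arctan T$, the left-hand side with $K=\infty$ equals $1$ at
  $t = 1/2$. The odd coefficients change only to second order in $t - 1/2$, whereas the even ones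
  vanish at $1/2$ to first order, so for $t$ slightly above $1/2$ it is strictly larger than $1$,
  and this survives a small decrease of $x$.
\<close>

section \<open>Coefficients of the resolvent series\<close>

lemma nc_mult_var:
  "nc_mult (nc_var i) f w = (case w of [] \<Rightarrow> 0 | a # v \<Rightarrow> if a = i then f v else 0)"
proof (cases w)
  case Nil
  then show ?thesis by (simp add: nc_mult_def nc_var_def)
next
  case (Cons a v)
  have "nc_mult (nc_var i) f w = (\<Sum>k\<in>{1}. nc_var i (take k w) * f (drop k w))"
    unfolding nc_mult_def
  proof (intro sum.mono_neutral_right ballI)
    fix k assume "k \<in> {..length w} - {1}"
    then have "length (take k w) \<noteq> 1" by auto
    then have "take k w \<noteq> [i]" by (metis One_nat_def length_Cons list.size(3))
    then show "nc_var i (take k w) * f (drop k w) = 0" by (simp add: nc_var_def)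
  qed (use Cons in auto)
  then show ?thesis by (simp add: Cons nc_var_def)
qed

lemma nc_power_var: "nc_power (nc_var i) k w = (if w = replicate k i then 1 else 0)"
proof (induction k arbitrary: w)
  case 0
  then show ?case by (simp add: nc_one_def)
next
  case (Suc k)
  then show ?case by (auto simp: nc_mult_var split: list.split)
qed

lemma nc_exp_var:
  "nc_exp (nc_var i) w = (if w = replicate (length w) i then 1 / fact (length w) else 0)"
proof -
  have "nc_exp (nc_var i) w = (\<Sum>k\<le>length w. nc_power (nc_var i) k w / fact k)"
    by (rule nc_exp_finite) (simp add: nc_var_def)
  also have "\<dots> = (\<Sum>k\<le>length w. if k = length w then
      (if w = replicate (length w) i then 1 / fact (length w) else 0) else 0)"
    by (intro sum.cong) (auto simp: nc_power_var)
  finally show ?thesis by simp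
qed

definition exp_prod :: "'v list \<Rightarrow> 'v ncps" where
  "exp_prod is = foldr nc_mult (map (\<lambda>i. nc_exp (nc_var i)) is) nc_one"

lemma exp_prod_Nil: "exp_prod [] = nc_one"
  and exp_prod_Cons: "exp_prod (i # is) = nc_mult (nc_exp (nc_var i)) (exp_prod is)"
  by (simp_all add: exp_prod_def)

lemma exp_prod_eq_0:
  assumes "\<not> set w \<subseteq> set is"
  shows "exp_prod is w = 0"
  using assms
proof (induction "is" arbitrary: w)
  case Nil
  then show ?case by (auto simp: exp_prod_Nil nc_one_def)
next
  case (Cons i "is")
  have "nc_exp (nc_var i) (take k w) * exp_prod is (drop k w) = 0" for k
  proof (cases "take k w = replicate (length (take k w)) i")
    case True
    then have "set (take k w) \<subseteq> {i}" by (metis set_replicate_conv_if empty_subsetI subset_refl)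
    moreover have "set w = set (take k w) \<union> set (drop k w)"
      by (metis append_take_drop_id set_append)
    ultimately have "\<not> set (drop k w) \<subseteq> set is" using Cons.prems by auto
    then show ?thesis using Cons.IH by simp
  next
    case False
    then show ?thesis using nc_exp_var[of i "take k w"] by simp
  qed
  then show ?case unfolding exp_prod_Cons nc_mult_def by (intro sum.neutral) simp
qed

text \<open>Only the split after the whole leading block survives: a shorter prefix leaves an
  \<open>i\<close> that no factor of \<open>is\<close> produces, and a longer one contains another
  letter, hence has coefficient 0 in the first exponential.\<close>

lemma exp_prod_Cons_replicate:
  assumes "i \<notin> set is" "u = [] \<or> hd u \<noteq> i"
  shows "exp_prod (i # is) (replicate k i @ u) = exp_prod is u / fact k"
proof -
  let ?w = "replicate k i @ u"
  have "exp_prod (i # is) ?w =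
      (\<Sum>j\<in>{k}. nc_exp (nc_var i) (take j ?w) * exp_prod is (drop j ?w))"
    unfolding exp_prod_Cons nc_mult_def
  proof (intro sum.mono_neutral_right ballI)
    fix j assume "j \<in> {..length ?w} - {k}"
    then consider "j < k" | "k < j" "j \<le> k + length u" by fastforce
    then show "nc_exp (nc_var i) (take j ?w) * exp_prod is (drop j ?w) = 0"
    proof cases
      case 1
      then have "i \<in> set (drop j ?w)" by simp
      then have "exp_prod is (drop j ?w) = 0" using assms(1) by (intro exp_prod_eq_0) auto
      then show ?thesis by simp
    next
      case 2
      then have "u \<noteq> []" by auto
      then obtain b u' where u: "u = b # u'" by (cases u) auto
      have "take j ?w = replicate k i @ b # take (j - k - 1) u'"
        using 2 u by (simp add: take_Cons' )
      then have "b \<in> set (take j ?w)" by simp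
      moreover have "b \<noteq> i" using assms(2) u by simp
      ultimately have "take j ?w \<noteq> replicate (length (take j ?w)) i"
        by (metis in_set_replicate)
      then have "nc_exp (nc_var i) (take j ?w) = 0" by (subst nc_exp_var) (rule if_not_P)
      then show ?thesis by simp
    qed
  qed auto
  then show ?thesis by (simp add: nc_exp_var)
qed

lemma exp_prod_empty: "exp_prod is [] = 1"
  by (induction "is") (simp_all add: exp_prod_Nil exp_prod_Cons nc_one_def nc_mult_def nc_exp_var)

text \<open>Indices increase along \<open>is\<close>, so the product contains only nondecreasing
  words: a maximal run of \<open>a\<close> splits off its exponential coefficient before a larger
  letter, and the coefficient vanishes before a smaller one.\<close>

lemma exp_prod_replicate:
  fixes a :: "'v::linorder"
  assumes "sorted_wrt (<) is" "a \<in> set is" "k > 0" "u = [] \<or> hd u \<noteq> a"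
  shows "exp_prod is (replicate k a @ u) =
    (if u = [] \<or> a < hd u then exp_prod is u / fact k else 0)"
  using assms(1,2)
proof (induction "is")
  case Nil
  then show ?case by simp
next
  case (Cons i "is")
  have i: "i \<notin> set is" using Cons.prems by auto
  \<comment> \<open>The case of an empty block: a factor whose letter does not head the word
    contributes only its constant term 1.\<close>
  have skip: "exp_prod (i # is) v = exp_prod is v" if "v = [] \<or> hd v \<noteq> i" for v
    using exp_prod_Cons_replicate[OF i that, of 0] by simp
  show ?case
  proof (cases "a = i")
    case True
    have *: "exp_prod (i # is) (replicate k a @ u) = exp_prod is u / fact k"
      using exp_prod_Cons_replicate[OF i] assms(4) True by simp
    show ?thesis
    proof (cases "u = [] \<or> a < hd u")
      case True
      then show ?thesis using * skip[of u] \<open>a = i\<close> assms(4) by auto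
    next
      case False
      then have "hd u \<notin> set is" using Cons.prems \<open>a = i\<close> by auto
      then have "\<not> set u \<subseteq> set is" using False by (meson hd_in_set subsetD)
      then show ?thesis using * False exp_prod_eq_0[of u "is"] by simp
    qed
  next
    case False
    then have "a \<in> set is" "i < a" using Cons.prems by auto
    then have "exp_prod (i # is) (replicate k a @ u) = exp_prod is (replicate k a @ u)"
      using skip[of "replicate k a @ u"] False \<open>k > 0\<close> by (cases k) auto
    also have "\<dots> = (if u = [] \<or> a < hd u then exp_prod is u / fact k else 0)"
      using Cons \<open>a \<in> set is\<close> by simp
    moreover have "exp_prod (i # is) u = exp_prod is u" if "u = [] \<or> a < hd u"
      using that \<open>i < a\<close> by (intro skip) auto
    ultimately show ?thesis by auto
  qed
qed

section \<open>The resolvent series f / (1 + t f) and the logarithm as its integral over t\<close>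

definition nc_resolvent :: "real \<Rightarrow> 'v ncps \<Rightarrow> 'v ncps" where
  "nc_resolvent t f w = (\<Sum>k<length w. (- t) ^ k * nc_power f (Suc k) w)"

text \<open>Powers beyond the word length vanish because \<open>f\<close> has no constant term. A
  common \<open>N\<close> then serves a word and all its suffixes in the recursion.\<close>

lemma nc_resolvent_eq:
  assumes "f [] = 0" "length w \<le> N"
  shows "nc_resolvent t f w = (\<Sum>k<N. (- t) ^ k * nc_power f (Suc k) w)"
  unfolding nc_resolvent_def
  using assms by (intro sum.mono_neutral_left) (auto simp del: nc_power.simps intro!: nc_power_eq_0)

lemma nc_mult_one_right: "nc_mult f nc_one = f"
proof
  fix w
  have "nc_mult f nc_one w = (\<Sum>k\<le>length w. if k = length w then f w else 0)"
    unfolding nc_mult_def nc_one_def by (intro sum.cong) auto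
  then show "nc_mult f nc_one w = f w" by simp
qed

text \<open>This is R = f - t f R, read coefficientwise. The cuts at both ends drop out because
  \<open>f\<close> and R vanish at the empty word.\<close>

lemma nc_resolvent_rec:
  assumes "f [] = 0"
  shows "nc_resolvent t f w =
    f w - t * (\<Sum>j\<in>{1..<length w}. f (take j w) * nc_resolvent t f (drop j w))"
proof -
  let ?N = "length w"
  \<comment> \<open>One power more than the length, so that \<open>?N\<close> terms remain once
    \<open>k = 0\<close> is split off.\<close>
  have "nc_resolvent t f w = (\<Sum>k<Suc ?N. (- t) ^ k * nc_power f (Suc k) w)"
    by (intro nc_resolvent_eq assms) simp
  also have "\<dots> = f w + (\<Sum>k<?N. (- t) ^ Suc k * nc_power f (Suc (Suc k)) w)"
    by (subst sum.lessThan_Suc_shift) (simp add: nc_mult_one_right)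
  also have "(\<Sum>k<?N. (- t) ^ Suc k * nc_power f (Suc (Suc k)) w) =
      (\<Sum>k<?N. \<Sum>j\<le>?N. - t * (f (take j w) * ((- t) ^ k * nc_power f (Suc k) (drop j w))))"
    by (intro sum.cong refl, subst nc_power.simps(2), subst nc_mult_def)
      (simp add: sum_distrib_left mult_ac)
  also have "\<dots> = (\<Sum>j\<le>?N. \<Sum>k<?N. - t * (f (take j w) * ((- t) ^ k * nc_power f (Suc k) (drop j w))))"
    by (rule sum.swap)
  also have "\<dots> = (\<Sum>j\<le>?N. - t * (f (take j w) * nc_resolvent t f (drop j w)))"
    by (intro sum.cong refl, subst nc_resolvent_eq[of f, OF assms, where N = ?N])
      (simp_all add: sum_distrib_left del: nc_power.simps)
  also have "\<dots> = (\<Sum>j\<in>{1..<?N}. - t * (f (take j w) * nc_resolvent t f (drop j w)))"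
  proof (intro sum.mono_neutral_right ballI)
    fix j assume "j \<in> {..?N} - {1..<?N}"
    then have "j = 0 \<or> j = ?N" by auto
    then show "- t * (f (take j w) * nc_resolvent t f (drop j w)) = 0"
      using assms by (auto simp: nc_resolvent_def)
  qed auto
  finally show ?thesis by (simp add: sum_distrib_left sum_negf)
qed

lemma nc_log_has_integral:
  assumes "f [] = 1"
  shows "((\<lambda>t. nc_resolvent t (\<lambda>v. f v - nc_one v) w) has_integral nc_log f w) {0..1}"
proof -
  let ?q = "nc_power (\<lambda>v. f v - nc_one v)"
  have "((\<lambda>t::real. (- t) ^ k * ?q (Suc k) w) has_integral
      ((-1) ^ k / real (Suc k) * ?q (Suc k) w)) {0..1}" for k
  proof (rule has_integral_mult_left)
    have "((\<lambda>t::real. (-t)^k) has_integral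
        ((-1) ^ k * 1 ^ Suc k / real (Suc k) - (-1) ^ k * 0 ^ Suc k / real (Suc k))) {0..1}"
    proof (rule fundamental_theorem_of_calculus)
      fix x :: real
      have "((\<lambda>t. (-1) ^ k * t ^ Suc k / real (Suc k)) has_real_derivative
          (-1) ^ k * (real (Suc k) * x ^ k) / real (Suc k)) (at x within {0..1})"
        by (rule derivative_eq_intros refl | simp)+
      moreover have "(-1) ^ k * (real (Suc k) * x ^ k) / real (Suc k) = (- x) ^ k"
        by (subst power_minus) simp
      ultimately show "((\<lambda>t. (-1) ^ k * t ^ Suc k / real (Suc k)) has_vector_derivative
          (- x) ^ k) (at x within {0..1})"
        by (simp only: has_real_derivative_iff_has_vector_derivative)
    qed simp
    then show "((\<lambda>t::real. (-t)^k) has_integral ((-1) ^ k / real (Suc k))) {0..1}" by simp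
  qed
  then show ?thesis
    unfolding nc_log_finite[of f, OF assms] nc_resolvent_def by (intro has_integral_sum) auto
qed

text \<open>The recursion expresses $G(z) = (e^z - 1) - t (e^z - 1) G(z)$ coefficientwise.\<close>

fun run_coeff :: "real \<Rightarrow> nat \<Rightarrow> real" where
  "run_coeff t k =
    (if k = 0 then 0 else 1 / fact k - t * (\<Sum>j\<in>{1..<k}. run_coeff t (k - j) / fact j))"

declare run_coeff.simps [simp del]

lemma continuous_on_run_coeff [continuous_intros]: "continuous_on S (\<lambda>t. run_coeff t k)"
proof (induction k rule: less_induct)
  case (less k)
  show ?case
    by (subst run_coeff.simps, cases "k = 0") (auto intro!: continuous_intros less)
qed

text \<open>Sort the cuts of the recursion by position. Cuts inside the run leave shorter runs and
  give the recursion of \<open>run_coeff\<close>; the cut at its end gives - t R(v) / k!. At an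
  ascent, the cuts beyond the run combine with \<open>f\<close> of the whole word to R(v) / k!, by
  the recursion for \<open>v\<close>; at a descent these terms vanish.\<close>

lemma nc_resolvent_replicate:
  fixes a :: "'v::linorder"
  assumes "is": "sorted_wrt (<) is" "a \<in> set is" and k: "k > 0" and v: "v = [] \<or> hd v \<noteq> a"
  defines "f \<equiv> \<lambda>v. exp_prod is v - nc_one v"
  shows "nc_resolvent t f (replicate k a @ v) = run_coeff t k *
    (if v = [] then 1 else (if a < hd v then 1 - t else - t) * nc_resolvent t f v)"
  using k
proof (induction k rule: less_induct)
  case (less k)
  let ?w = "replicate k a @ v" and ?R = "nc_resolvent t f"
  let ?s = "\<lambda>j. f (take j ?w) * ?R (drop j ?w)"
  let ?c = "if v = [] then 1 else (if a < hd v then 1 - t else - t) * ?R v"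
  have f0: "f [] = 0" by (simp add: f_def exp_prod_empty nc_one_def)
  have f_app: "f (replicate j a @ u) =
      (if u = [] then 1 / fact j else if a < hd u then f u / fact j else 0)"
    if "j > 0" "u = [] \<or> hd u \<noteq> a" for j u
    using exp_prod_replicate[OF "is" that] that
    by (auto simp: f_def nc_one_def exp_prod_empty)
  have rec: "?R ?w = f ?w - t * (\<Sum>j\<in>{1..<length ?w}. ?s j)"
    using nc_resolvent_rec[of f, OF f0] .
  have low: "(\<Sum>j\<in>{1..<k}. ?s j) = (\<Sum>j\<in>{1..<k}. run_coeff t (k - j) / fact j) * ?c"
    unfolding sum_distrib_right
  proof (intro sum.cong refl)
    fix j assume j: "j \<in> {1..<k}"
    then have "f (take j ?w) = 1 / fact j" using f_app[of j "[]"] by (simp add: min_def)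
    moreover have "?R (drop j ?w) = run_coeff t (k - j) * ?c"
      using less.IH[of "k - j"] j by simp
    ultimately show "?s j = run_coeff t (k - j) / fact j * ?c" by simp
  qed
  have G: "run_coeff t k = 1 / fact k - t * (\<Sum>j\<in>{1..<k}. run_coeff t (k - j) / fact j)"
    using less.prems by (subst run_coeff.simps) simp
  show ?case
  proof (cases "v = []")
    case True
    then have "f ?w = 1 / fact k" using f_app[of k "[]"] less.prems by simp
    then show ?thesis using rec low True G by simp
  next
    case False
    have "{1..<length ?w} = {1..<k} \<union> ({k} \<union> {k + 1..<k + length v})"
      using False less.prems by (auto simp: neq_Nil_conv)
    then have "(\<Sum>j\<in>{1..<length ?w}. ?s j) =
        (\<Sum>j\<in>{1..<k}. ?s j) + (?s k + (\<Sum>j\<in>{k + 1..<k + length v}. ?s j))"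
      by (simp only:) (subst sum.union_disjoint; auto)
    also have "(\<Sum>j\<in>{k + 1..<k + length v}. ?s j) = (\<Sum>j\<in>{1..<length v}. ?s (j + k))"
      using sum.shift_bounds_nat_ivl[of ?s 1 k "length v"] by (simp add: add.commute)
    also have "\<dots> = (if a < hd v then
        (\<Sum>j\<in>{1..<length v}. f (take j v) * ?R (drop j v)) / fact k else 0)"
    proof -
      have "?s (j + k) = (if a < hd v then f (take j v) * ?R (drop j v) / fact k else 0)"
        if "j \<in> {1..<length v}" for j
      proof -
        have "take j v \<noteq> []" "hd (take j v) = hd v" using that by auto
        then show ?thesis using f_app[of k "take j v"] less.prems v False by simp
      qed
      then have "(\<Sum>j\<in>{1..<length v}. ?s (j + k)) =
          (\<Sum>j\<in>{1..<length v}. if a < hd v then f (take j v) * ?R (drop j v) / fact k else 0)"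
        by (intro sum.cong) auto
      then show ?thesis by (simp add: sum_divide_distrib)
    qed
    finally have split: "(\<Sum>j\<in>{1..<length ?w}. ?s j) = (\<Sum>j\<in>{1..<k}. ?s j) + (?s k +
      (if a < hd v then (\<Sum>j\<in>{1..<length v}. f (take j v) * ?R (drop j v)) / fact k else 0))" .
    have sk: "?s k = ?R v / fact k" using f_app[of k "[]"] less.prems by simp
    have fw: "f ?w = (if a < hd v then f v / fact k else 0)"
      using f_app[of k v] less.prems v False by simp
    have fv: "f v = ?R v + t * (\<Sum>j\<in>{1..<length v}. f (take j v) * ?R (drop j v))"
      using nc_resolvent_rec[of f, OF f0, of t v] by simp
    have "?R ?w = - t * (\<Sum>j\<in>{1..<k}. ?s j) +
        (if a < hd v then 1 - t else - t) * ?R v / fact k"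
      unfolding rec split sk fw fv by (simp add: algebra_simps add_divide_distrib diff_divide_distrib)
    then show ?thesis unfolding low using False by (simp add: G algebra_simps)
  qed
qed

section \<open>Words as sequences of runs\<close>

fun run_word :: "'v list \<Rightarrow> nat list \<Rightarrow> 'v list" where
  "run_word (a # as) (k # ks) = replicate k a @ run_word as ks"
| "run_word _ _ = []"

text \<open>Moduli of the step factors \<open>1 - t\<close> and \<open>- t\<close>. Their sign, kept
  in \<open>step_sign\<close>, does not depend on \<open>t\<close> and can leave the
  integral.\<close>

fun step_weight :: "real \<Rightarrow> 'v::linorder list \<Rightarrow> real" where
  "step_weight t (a # b # as) = (if a < b then 1 - t else t) * step_weight t (b # as)"
| "step_weight t _ = 1"

fun step_sign :: "'v::linorder list \<Rightarrow> real" where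
  "step_sign (a # b # as) = (if a < b then 1 else - 1) * step_sign (b # as)"
| "step_sign _ = 1"

lemma abs_step_sign: "\<bar>step_sign as\<bar> = 1"
  by (induction as rule: step_sign.induct) (auto simp: abs_mult)

lemma nc_resolvent_run_word:
  fixes as :: "'v::linorder list"
  assumes "is": "sorted_wrt (<) is"
    and "length as = length ks" "as \<noteq> []" "set as \<subseteq> set is" "distinct_adj as" "0 \<notin> set ks"
  shows "nc_resolvent t (\<lambda>v. exp_prod is v - nc_one v) (run_word as ks) =
    step_sign as * step_weight t as * prod_list (map (run_coeff t) ks)"
  using assms(2-)
proof (induction as ks rule: list_induct2)
  case Nil
  then show ?case by simp
next
  case (Cons a as k ks)
  have k: "a \<in> set is" "k > 0" using Cons.prems by auto
  show ?case
  proof (cases as)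
    case Nil
    then show ?thesis using Cons nc_resolvent_replicate[OF "is" k, of "[]" t] by simp
  next
    case (Cons b as')
    then obtain k' ks' where ks: "ks = k' # ks'" using \<open>length as = length ks\<close> by (cases ks) auto
    have "run_word as ks \<noteq> [] \<and> hd (run_word as ks) = b \<and> a \<noteq> b"
      using Cons.prems \<open>as = _\<close> ks by (cases k') auto
    then show ?thesis
      using nc_resolvent_replicate[OF "is" k, of "run_word as ks" t] Cons.IH Cons.prems \<open>as = _\<close>
      by (auto simp: algebra_simps)
  qed
qed

lemma length_run_word: "length as = length ks \<Longrightarrow> length (run_word as ks) = sum_list ks"
  by (induction as ks rule: list_induct2) auto

lemma set_run_word: "set (run_word as ks) \<subseteq> set as"
  by (induction as ks rule: run_word.induct) auto

text \<open>The first letter recovers the first run through \<open>takeWhile\<close> and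
  \<open>dropWhile\<close>, and induction does the rest. Hence no monomial is counted twice when
  words are enumerated by run data.\<close>

lemma run_word_inject:
  assumes "length as = length ks" "distinct_adj as" "0 \<notin> set ks"
    and "length bs = length ls" "distinct_adj bs" "0 \<notin> set ls"
    and "run_word as ks = run_word bs ls"
  shows "as = bs \<and> ks = ls"
  using assms
proof (induction as ks arbitrary: bs ls rule: list_induct2)
  case Nil
  then show ?case by (cases bs; cases ls) auto
next
  case (Cons a as k ks)
  have split: "takeWhile ((=) c) (run_word (c # cs) (m # ms)) = replicate m c \<and>
      dropWhile ((=) c) (run_word (c # cs) (m # ms)) = run_word cs ms"
    if "length cs = length ms" "distinct_adj (c # cs)" "0 \<notin> set ms"
    for c :: 'a and cs m and ms :: "nat list"
  proof -
    have "run_word cs ms = [] \<or> hd (run_word cs ms) \<noteq> c"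
      using that by (cases cs; cases ms; cases "hd ms") auto
    then have "takeWhile ((=) c) (run_word cs ms) = []"
        "dropWhile ((=) c) (run_word cs ms) = run_word cs ms"
      by (cases "run_word cs ms"; auto)+
    then show ?thesis unfolding run_word.simps by (induction m) auto
  qed
  obtain b bs' l ls' where eq: "bs = b # bs'" "ls = l # ls'" "length bs' = length ls'"
    using Cons.prems by (cases bs; cases ls; cases k) auto
  have "k > 0" "l > 0" using Cons.prems eq by auto
  have "hd (replicate m c @ u) = c" if "m > 0" for m and c :: 'a and u
    using that by (cases m) auto
  then have "hd (run_word (a # as) (k # ks)) = a" "hd (run_word bs ls) = b"
    using eq \<open>k > 0\<close> \<open>l > 0\<close> by simp_all
  then have "a = b" using Cons.prems by simp
  have *: "length as = length ks" "distinct_adj (a # as)" "0 \<notin> set ks"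
    "length bs' = length ls'" "distinct_adj (a # bs')" "0 \<notin> set ls'"
    using Cons.hyps Cons.prems eq \<open>a = b\<close> by auto
  have "run_word (a # as) (k # ks) = run_word (a # bs') (l # ls')"
    using Cons.prems(6) by (simp only: eq \<open>a = b\<close>)
  then have "replicate k a = replicate l a" "run_word as ks = run_word bs' ls'"
    using split[OF *(1-3), of k] split[OF *(4-6), of l] by (simp_all only:)
  moreover have "as = bs' \<and> ks = ls'"
    using * calculation by (intro Cons.IH) (auto dest: distinct_adj_ConsD)
  ultimately show ?case using eq \<open>a = b\<close> by (auto dest: arg_cong[of _ _ length])
qed

section \<open>Ascents and descents in words without equal neighbours\<close>

definition adj_words :: "nat \<Rightarrow> nat \<Rightarrow> nat list set" where
  "adj_words n m = {as. length as = m \<and> set as \<subseteq> {..<n} \<and> distinct_adj as}"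

lemma finite_adj_words: "finite (adj_words n m)"
  by (rule finite_subset[OF _ finite_lists_length_eq[of "{..<n}" m]]) (auto simp: adj_words_def)

text \<open>Prepending a letter excludes at most the head of the word, so at least
  \<open>n - 1\<close> choices remain; \<open>take 1\<close> covers the empty word as well.\<close>

lemma card_adj_words: "card (adj_words n m) \<ge> (n - 1) ^ m"
proof (induction m)
  case 0
  have "adj_words n 0 = {[]}" by (auto simp: adj_words_def)
  then show ?case by simp
next
  case (Suc m)
  let ?S = "SIGMA as:adj_words n m. {..<n} - set (take 1 as)"
  have "(n - 1) ^ Suc m \<le> (n - 1) * card (adj_words n m)" using Suc by simp
  also have "\<dots> \<le> (\<Sum>as\<in>adj_words n m. card ({..<n} - set (take 1 as)))"
  proof -
    have "n - 1 \<le> card ({..<n} - set (take 1 as))" for as :: "nat list"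
    proof -
      have "card (set (take 1 as)) \<le> 1"
        by (rule order_trans[OF card_length]) simp
      then show ?thesis using diff_card_le_card_Diff[of "set (take 1 as)" "{..<n}"] by simp
    qed
    then show ?thesis
      using sum_bounded_below[of "adj_words n m" "n - 1" "\<lambda>as. card ({..<n} - set (take 1 as))"]
      by (simp add: mult.commute)
  qed
  also have "\<dots> = card ?S" by (rule card_SigmaI[symmetric]) (auto simp: finite_adj_words)
  also have "\<dots> = card ((\<lambda>(as, a). a # as) ` ?S)"
    by (rule card_image[symmetric]) (auto simp: inj_on_def)
  also have "\<dots> \<le> card (adj_words n (Suc m))"
  proof (intro card_mono finite_adj_words subsetI)
    fix w assume "w \<in> (\<lambda>(as, a). a # as) ` ?S"
    then obtain as a where "w = a # as" "as \<in> adj_words n m" "a < n" "a \<notin> set (take 1 as)"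
      by auto
    then show "w \<in> adj_words n (Suc m)" by (cases as) (auto simp: adj_words_def)
  qed
  finally show ?case .
qed

lemma step_weight_nonneg: "0 \<le> t \<Longrightarrow> t \<le> 1 \<Longrightarrow> 0 \<le> step_weight t as"
  by (induction t as rule: step_weight.induct) auto

text \<open>Every step contributes \<open>t\<close> to one factor and \<open>1 - t\<close> to the
  other. A nonempty word has one step fewer than letters, and the spare factor t (1 - t) is at most
  1.\<close>

lemma step_weight_mult_flip:
  assumes "0 \<le> t" "t \<le> 1"
  shows "step_weight t as * step_weight (1 - t) as \<ge> (t * (1 - t)) ^ length as"
  using assms
proof (induction t as rule: step_weight.induct)
  case (1 t a b as)
  have "(t * (1 - t)) ^ length (a # b # as) \<le>
      t * (1 - t) * (step_weight t (b # as) * step_weight (1 - t) (b # as))"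
    using 1 by (simp add: mult_left_mono)
  then show ?case by (simp add: mult_ac)
next
  case ("2_2" t a)
  then show ?case using mult_mono[of t 1 "1 - t" 1] by simp
qed auto

text \<open>Reversing the alphabet exchanges ascents and descents; equal neighbours would count as
  descents before and after.\<close>

lemma step_weight_reflect:
  fixes n :: nat
  assumes "set as \<subseteq> {..<n}" "distinct_adj as"
  shows "step_weight t (map (\<lambda>a. n - 1 - a) as) = step_weight (1 - t) as"
  using assms
proof (induction t as rule: step_weight.induct)
  case (1 t a b as)
  have "n - 1 - a < n - 1 - b \<longleftrightarrow> \<not> a < b"
  proof -
    have "a < n" "b < n" "a \<noteq> b" using 1(2,3) by auto
    then show ?thesis by arith
  qed
  moreover have "step_weight t (map (\<lambda>a. n - 1 - a) (b # as)) = step_weight (1 - t) (b # as)"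
    using 1 by (intro 1(1)) auto
  ultimately show ?case by (simp only: list.map step_weight.simps) auto
qed simp_all

lemma sum_step_weight_flip:
  "(\<Sum>as\<in>adj_words n m. step_weight (1 - t) as) = (\<Sum>as\<in>adj_words n m. step_weight t as)"
proof -
  let ?f = "map (\<lambda>a. n - 1 - a)"
  have mem: "?f as \<in> adj_words n m" if "as \<in> adj_words n m" for as
  proof -
    have "inj_on (\<lambda>a. n - 1 - a) (set as)"
    proof (rule inj_onI)
      fix x y assume "x \<in> set as" "y \<in> set as" "n - 1 - x = n - 1 - y"
      moreover from this have "x < n" "y < n" using that by (auto simp: adj_words_def)
      ultimately show "x = y" by arith
    qed
    then show ?thesis using that
      by (auto simp: adj_words_def distinct_adj_map_iff)
  qed
  have inv: "?f (?f as) = as" if "as \<in> adj_words n m" for as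
    using that by (auto simp: adj_words_def intro!: map_idI)
  show ?thesis
  proof (rule sum.reindex_bij_witness[where i = ?f and j = ?f])
    fix as assume "as \<in> adj_words n m"
    then show "step_weight t (?f as) = step_weight (1 - t) as"
      by (intro step_weight_reflect) (auto simp: adj_words_def)
  qed (use mem inv in auto)
qed

text \<open>By the reflection symmetry the sum is the average of its values at \<open>t\<close> and
  \<open>1 - t\<close>. For each word AM-GM bounds this average from below by the geometric mean,
  and at least (n - 1)^m words contribute.\<close>

lemma sum_step_weight_ge:
  assumes t: "0 \<le> t" "t \<le> 1"
  shows "(\<Sum>as\<in>adj_words n m. step_weight t as) \<ge> (real (n - 1) * sqrt (t * (1 - t))) ^ m"
proof -
  let ?r = "sqrt (t * (1 - t))" and ?W = "\<lambda>t. \<Sum>as\<in>adj_words n m. step_weight t as"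
  have r: "?r \<ge> 0" using t by simp
  have "2 * ?r ^ m \<le> step_weight t as + step_weight (1 - t) as" if "as \<in> adj_words n m" for as
  proof -
    let ?x = "step_weight t as" and ?y = "step_weight (1 - t) as"
    have nonneg: "0 \<le> ?x" "0 \<le> ?y" using t by (auto intro: step_weight_nonneg)
    have "?r ^ m = sqrt ((t * (1 - t)) ^ m)" by (simp add: real_sqrt_power)
    also have "\<dots> \<le> sqrt (?x * ?y)"
      using step_weight_mult_flip[OF t, of as] that by (simp add: adj_words_def)
    also have "\<dots> \<le> (?x + ?y) / 2" by (rule arith_geo_mean_sqrt[OF nonneg])
    finally show ?thesis by simp
  qed
  then have "(\<Sum>as\<in>adj_words n m. 2 * ?r ^ m) \<le> ?W t + ?W (1 - t)"
    unfolding sum.distrib[symmetric] by (intro sum_mono)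
  then have "real (card (adj_words n m)) * ?r ^ m \<le> ?W t"
    unfolding sum_step_weight_flip by simp
  moreover have "real ((n - 1) ^ m) * ?r ^ m \<le> real (card (adj_words n m)) * ?r ^ m"
    using card_adj_words[of n m] r by (intro mult_right_mono) (auto simp only: of_nat_le_iff zero_le_power)
  ultimately show ?thesis by (simp add: power_mult_distrib)
qed

section \<open>Parity types of run lengths\<close>

lemma prod_list_map_eq_prod_count:
  fixes f :: "'a \<Rightarrow> 'b::comm_monoid_mult"
  assumes "finite A" "set xs \<subseteq> A"
  shows "prod_list (map f xs) = (\<Prod>x\<in>A. f x ^ count_list xs x)"
  using assms(2)
proof (induction xs)
  case (Cons a xs)
  have "(\<Prod>x\<in>A. f x ^ count_list (a # xs) x) =
      (\<Prod>x\<in>A. (if a = x then f x else 1) * f x ^ count_list xs x)"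
    by (intro prod.cong) auto
  also have "\<dots> = f a * (\<Prod>x\<in>A. f x ^ count_list xs x)"
    using assms(1) Cons.prems by (simp add: prod.distrib prod.delta)
  finally show ?case using Cons by simp
qed simp

definition odd_letters :: "'a list \<Rightarrow> 'a set" where
  "odd_letters xs = {x. odd (count_list xs x)}"

text \<open>In the concatenation every letter occurs an even number of times, so the product
  consists of even powers.\<close>

lemma prod_list_mult_nonneg_if_same_parity:
  fixes f :: "'a \<Rightarrow> 'b::linordered_idom"
  assumes "odd_letters xs = odd_letters ys"
  shows "0 \<le> prod_list (map f xs) * prod_list (map f ys)"
proof -
  have "prod_list (map f xs) * prod_list (map f ys) = prod_list (map f (xs @ ys))" by simp
  also have "\<dots> = (\<Prod>x\<in>set (xs @ ys). f x ^ count_list (xs @ ys) x)"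
    by (rule prod_list_map_eq_prod_count) simp_all
  also have "\<dots> \<ge> 0"
    using assms by (intro prod_nonneg ballI zero_le_even_power)
      (auto simp: odd_letters_def count_list_append set_eq_iff)
  finally show ?thesis .
qed

lemma sum_prod_list_lists_length:
  fixes f :: "'a \<Rightarrow> 'b::comm_semiring_1"
  shows "(\<Sum>xs | set xs \<subseteq> A \<and> length xs = m. prod_list (map f xs)) = (\<Sum>x\<in>A. f x) ^ m"
proof (induction m)
  case 0
  have "{xs. set xs \<subseteq> A \<and> length xs = 0} = {[]}" by auto
  then show ?case by simp
next
  case (Suc m)
  let ?L = "{xs. set xs \<subseteq> A \<and> length xs = m}"
  have "(\<Sum>x\<in>A. f x) ^ Suc m = (\<Sum>xs\<in>?L. prod_list (map f xs)) * (\<Sum>x\<in>A. f x)"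
    by (simp add: Suc mult.commute)
  also have "\<dots> = (\<Sum>(xs, x)\<in>?L \<times> A. prod_list (map f xs) * f x)"
    by (simp add: sum_product sum.cartesian_product)
  also have "\<dots> = (\<Sum>xs | set xs \<subseteq> A \<and> length xs = Suc m. prod_list (map f xs))"
    unfolding lists_length_Suc_eq
    by (subst sum.reindex) (auto simp: inj_on_def mult.commute intro!: sum.cong)
  finally show ?case ..
qed

text \<open>The m-th power is a sum over lists of length \<open>m\<close>. Grouping it by parity
  type and applying Cauchy-Schwarz to the group sums leaves only pairs of one type. The loss
  \<open>2 ^ card A\<close> does not depend on \<open>m\<close>, so exponential growth in
  \<open>m\<close> survives.\<close>

lemma sum_same_parity_ge:
  fixes f :: "'a \<Rightarrow> real" and m :: nat
  assumes "finite A"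
  defines "L \<equiv> {xs. set xs \<subseteq> A \<and> length xs = m}"
  shows "(\<Sum>x\<in>A. f x) ^ (2 * m) \<le> 2 ^ card A *
    (\<Sum>(xs, ys) | xs \<in> L \<and> ys \<in> L \<and> odd_letters xs = odd_letters ys.
      prod_list (map f xs) * prod_list (map f ys))"
proof -
  let ?p = "\<lambda>xs. prod_list (map f xs)"
  let ?F = "\<lambda>P. {xs \<in> L. odd_letters xs = P}"
  have L: "finite L" unfolding L_def by (rule finite_lists_length_eq[OF assms(1)])
  have odd: "odd_letters xs \<in> Pow A" if "xs \<in> L" for xs
    using that by (auto simp: odd_letters_def L_def) (metis count_list_0_iff even_zero subsetD)
  have "(\<Sum>x\<in>A. f x) ^ (2 * m) = (\<Sum>xs\<in>L. ?p xs)\<^sup>2"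
    unfolding L_def sum_prod_list_lists_length by (simp add: power_mult mult.commute)
  also have "(\<Sum>xs\<in>L. ?p xs) = (\<Sum>P\<in>Pow A. \<Sum>xs\<in>?F P. ?p xs)"
    using L assms(1) odd by (intro sum.group[symmetric]) auto
  also have "(\<dots>)\<^sup>2 \<le> (\<Sum>P\<in>Pow A. (\<Sum>xs\<in>?F P. ?p xs)\<^sup>2) * card (Pow A)"
    by (rule sum_squared_le_sum_of_squares)
  also have "(\<Sum>P\<in>Pow A. (\<Sum>xs\<in>?F P. ?p xs)\<^sup>2) =
      (\<Sum>P\<in>Pow A. \<Sum>(xs, ys)\<in>?F P \<times> ?F P. ?p xs * ?p ys)"
    by (simp add: power2_eq_square sum_product sum.cartesian_product)
  also have "\<dots> = (\<Sum>(P, xs, ys)\<in>(SIGMA P:Pow A. ?F P \<times> ?F P). ?p xs * ?p ys)"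
    using L assms(1) by (subst sum.Sigma) (auto simp: case_prod_beta)
  also have "\<dots> = (\<Sum>(xs, ys) | xs \<in> L \<and> ys \<in> L \<and> odd_letters xs = odd_letters ys. ?p xs * ?p ys)"
    by (rule sum.reindex_bij_witness[where i = "\<lambda>(xs, ys). (odd_letters xs, xs, ys)" and j = snd])
      (use odd in auto)
  finally show ?thesis by (simp add: card_Pow assms(1) mult.commute)
qed

section \<open>Divergence criterion\<close>

lemma Gamma_real_replicate_ge:
  assumes x: "x \<ge> 0" and F: "finite F" "F \<subseteq> lists {..<n}"
  shows "ennreal (\<Sum>w\<in>F. \<bar>bch n w\<bar> * x ^ length w) \<le> Gamma_real (replicate n x)"
proof -
  have "ennreal (\<Sum>w\<in>F. \<bar>bch n w\<bar> * x ^ length w) =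
      (\<Sum>w\<in>F. ennreal (Gamma_bch n w * prod_list (map (\<lambda>i. replicate n x ! i) w)))"
  proof (subst sum_ennreal[symmetric])
    have "prod_list (map (\<lambda>i. replicate n x ! i) w) = x ^ length w" if "set w \<subseteq> {..<n}" for w
      using that by (induction w) auto
    then show "(\<Sum>w\<in>F. ennreal (\<bar>bch n w\<bar> * x ^ length w)) =
        (\<Sum>w\<in>F. ennreal (Gamma_bch n w * prod_list (map (\<lambda>i. replicate n x ! i) w)))"
      using F by (intro sum.cong) (auto simp: Gamma_bch_def in_lists_conv_set subset_iff)
  qed (use x in auto)
  also have "\<dots> \<le> Gamma_real (replicate n x)"
    unfolding Gamma_real_def using F by (subst nonneg_infsum_complete) (auto intro!: SUP_upper)
  finally show ?thesis .
qed

text \<open>Only words with \<open>2 * m\<close> runs are kept whose run lengths form two halves of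
  equal parity type. Their sign-corrected integrands are nonnegative on the whole unit interval, so
  the integral is at least the contribution of \<open>{a..b}\<close>.\<close>

lemma Gamma_real_ge_power:
  assumes x: "x \<ge> 0" and ab: "0 \<le> a" "a \<le> b" "b \<le> 1" and \<rho>: "\<rho> \<ge> 0"
    and rate: "\<And>t. t \<in> {a..b} \<Longrightarrow>
      \<rho> \<le> real (n - 1) * sqrt (t * (1 - t)) * (\<Sum>k\<in>{1..K}. \<bar>run_coeff t k\<bar> * x ^ k)"
    and m: "m > 0"
  shows "ennreal ((b - a) * \<rho> ^ (2 * m) / 2 ^ K) \<le> Gamma_real (replicate n x)"
proof -
  define L where "L = {ks. set ks \<subseteq> {1..K} \<and> length ks = m}"
  define J where "J = {(ks, ls). ks \<in> L \<and> ls \<in> L \<and> odd_letters ks = odd_letters ls}"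
  define word where "word = (\<lambda>(as :: nat list, ks, ls). run_word as (ks @ ls))"
  let ?I = "adj_words n (2 * m) \<times> J"
  \<comment> \<open>\<open>g\<close> absorbs the powers of \<open>x\<close> run by run.
    \<open>h\<close> is the sum of all sign-corrected integrands; it factors because letters and run
    lengths vary independently.\<close>
  define g where "g = (\<lambda>t ks. prod_list (map (\<lambda>k. run_coeff t k * x ^ k) ks))"
  define h where "h = (\<lambda>t. (\<Sum>as\<in>adj_words n (2 * m). step_weight t as) *
    (\<Sum>(ks, ls)\<in>J. g t ks * g t ls))"
  have "finite L" unfolding L_def by (intro finite_lists_length_eq) simp
  then have finJ: "finite J" by (intro finite_subset[of J "L \<times> L"]) (auto simp: J_def)
  then have finI: "finite ?I" by (simp add: finite_adj_words)
  have inj: "inj_on word ?I"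
  proof (rule inj_onI)
    fix p q assume pq: "p \<in> ?I" "q \<in> ?I" "word p = word q"
    obtain as ks ls as' ks' ls' where [simp]: "p = (as, ks, ls)" "q = (as', ks', ls')"
      by (metis prod.exhaust)
    have as: "as \<in> adj_words n (2 * m)" "as' \<in> adj_words n (2 * m)"
      and J: "(ks, ls) \<in> J" "(ks', ls') \<in> J" and eq: "word (as, ks, ls) = word (as', ks', ls')"
      using pq by auto
    \<comment> \<open>Since \<open>ks\<close> and \<open>ks'\<close> both have length
      \<open>m\<close>, the concatenations determine the two halves.\<close>
    have "as = as' \<and> ks @ ls = ks' @ ls'"
      using as J eq by (intro run_word_inject) (auto simp: word_def adj_words_def J_def L_def)
    then show "p = q" using J by (auto simp: J_def L_def)
  qed
  \<comment> \<open>Multiplication by \<open>step_sign as\<close>, whose square is 1, moves the sign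
    from the integrand to the coefficient.\<close>
  have bch: "((\<lambda>t. step_weight t as * (g t ks * g t ls)) has_integral
      (step_sign as * bch n (word (as, ks, ls)) * x ^ length (word (as, ks, ls)))) {0..1}"
    if as: "as \<in> adj_words n (2 * m)" and J: "(ks, ls) \<in> J" for as ks ls
  proof -
    let ?w = "word (as, ks, ls)"
    have "((\<lambda>t. nc_resolvent t (\<lambda>v. exp_prod [0..<n] v - nc_one v) ?w) has_integral bch n ?w) {0..1}"
      unfolding bch_def exp_prod_def[symmetric] by (rule nc_log_has_integral[of "exp_prod [0..<n]", OF exp_prod_empty])
    moreover have "nc_resolvent t (\<lambda>v. exp_prod [0..<n] v - nc_one v) ?w = step_sign as *
        (step_weight t as * prod_list (map (run_coeff t) (ks @ ls)))" for t
    proof -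
      have "nc_resolvent t (\<lambda>v. exp_prod [0..<n] v - nc_one v) (run_word as (ks @ ls)) =
          step_sign as * step_weight t as * prod_list (map (run_coeff t) (ks @ ls))"
        using as J m by (intro nc_resolvent_run_word) (auto simp: adj_words_def J_def L_def)
      then show ?thesis by (simp add: word_def)
    qed
    ultimately have "((\<lambda>t. step_sign as * (step_weight t as * prod_list (map (run_coeff t) (ks @ ls))))
        has_integral bch n ?w) {0..1}"
      by simp
    from has_integral_mult_right[OF has_integral_mult_left[OF this, of "x ^ length ?w"], of "step_sign as"]
    have "((\<lambda>t. step_sign as * (step_sign as * (step_weight t as *
        prod_list (map (run_coeff t) (ks @ ls))) * x ^ length ?w))
        has_integral (step_sign as * bch n ?w * x ^ length ?w)) {0..1}"
      by (simp add: mult_ac)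
    moreover have "step_sign as * step_sign as = 1"
      using abs_step_sign[of as] by (metis abs_mult_self_eq mult_1)
    moreover have "prod_list (map (run_coeff t) (ks @ ls)) * x ^ length ?w = g t ks * g t ls" for t
    proof -
      have *: "prod_list (map (run_coeff t) js) * x ^ sum_list js = g t js" for js
        by (induction js) (auto simp: g_def power_add)
      have len: "length ?w = sum_list (ks @ ls)"
        unfolding word_def using as J
        by (auto intro!: length_run_word simp: adj_words_def J_def L_def simp del: sum_list_append)
      have "prod_list (map (run_coeff t) (ks @ ls)) * x ^ length ?w =
          (prod_list (map (run_coeff t) ks) * x ^ sum_list ks) *
          (prod_list (map (run_coeff t) ls) * x ^ sum_list ls)"
        unfolding len by (simp add: power_add)
      then show ?thesis unfolding * .
    qed
    ultimately show ?thesis by (simp add: mult.assoc[symmetric]) (simp add: mult.assoc)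
  qed
  have h_nonneg: "0 \<le> h t" if "t \<in> {0..1}" for t
    unfolding h_def g_def using that
    by (intro mult_nonneg_nonneg sum_nonneg)
      (auto intro!: step_weight_nonneg prod_list_mult_nonneg_if_same_parity simp: J_def)
  have h_ge: "\<rho> ^ (2 * m) / 2 ^ K \<le> h t" if t: "t \<in> {a..b}" for t
  proof -
    let ?A = "\<Sum>as\<in>adj_words n (2 * m). step_weight t as" and ?B = "\<Sum>(ks, ls)\<in>J. g t ks * g t ls"
    let ?S = "\<Sum>k\<in>{1..K}. \<bar>run_coeff t k\<bar> * x ^ k" and ?r = "real (n - 1) * sqrt (t * (1 - t))"
    have t01: "0 \<le> t" "t \<le> 1" using t ab by auto
    have g_abs: "\<bar>g t ks\<bar> = prod_list (map (\<lambda>k. \<bar>run_coeff t k\<bar> * x ^ k) ks)" for ks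
      unfolding g_def using x by (induction ks) (auto simp: abs_mult)
    have "?S ^ (2 * m) \<le> 2 ^ K * (\<Sum>(ks, ls)\<in>J. \<bar>g t ks\<bar> * \<bar>g t ls\<bar>)"
      using sum_same_parity_ge[of "{1..K}" "\<lambda>k. \<bar>run_coeff t k\<bar> * x ^ k" m]
      unfolding g_abs J_def L_def by simp
    also have "(\<Sum>(ks, ls)\<in>J. \<bar>g t ks\<bar> * \<bar>g t ls\<bar>) = ?B"
    proof (intro sum.cong refl, clarify)
      fix ks ls assume "(ks, ls) \<in> J"
      then have "0 \<le> g t ks * g t ls"
        unfolding g_def by (intro prod_list_mult_nonneg_if_same_parity) (auto simp: J_def)
      then show "\<bar>g t ks\<bar> * \<bar>g t ls\<bar> = g t ks * g t ls" by (metis abs_mult abs_of_nonneg)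
    qed
    finally have B: "?S ^ (2 * m) / 2 ^ K \<le> ?B" by (simp add: field_simps)
    have "\<rho> ^ (2 * m) \<le> (?r * ?S) ^ (2 * m)" by (intro power_mono rate t \<rho>)
    then have "\<rho> ^ (2 * m) / 2 ^ K \<le> ?r ^ (2 * m) * (?S ^ (2 * m) / 2 ^ K)"
      by (simp add: power_mult_distrib divide_right_mono)
    also have "\<dots> \<le> ?A * ?B"
      using x by (intro mult_mono B sum_step_weight_ge t01 sum_nonneg step_weight_nonneg) (auto intro!: sum_nonneg divide_nonneg_nonneg zero_le_power)
    finally show ?thesis by (simp add: h_def)
  qed
  have "h = (\<lambda>t. \<Sum>(as, ks, ls)\<in>?I. step_weight t as * (g t ks * g t ls))"
    unfolding h_def by (auto simp: sum_product sum.cartesian_product case_prod_beta)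
  moreover have "((\<lambda>t. \<Sum>(as, ks, ls)\<in>?I. step_weight t as * (g t ks * g t ls)) has_integral
      (\<Sum>(as, ks, ls)\<in>?I. step_sign as * bch n (word (as, ks, ls)) * x ^ length (word (as, ks, ls)))) {0..1}"
    unfolding case_prod_beta using bch by (intro has_integral_sum finI) auto
  ultimately have h_int: "(h has_integral
      (\<Sum>(as, ks, ls)\<in>?I. step_sign as * bch n (word (as, ks, ls)) * x ^ length (word (as, ks, ls)))) {0..1}"
    by simp
  have "((\<lambda>_. \<rho> ^ (2 * m) / 2 ^ K) has_integral (b - a) * (\<rho> ^ (2 * m) / 2 ^ K)) {a..b}"
    using has_integral_const_real[of "\<rho> ^ (2 * m) / 2 ^ K" a b] ab by simp
  then have "((\<lambda>t. if t \<in> {a..b} then \<rho> ^ (2 * m) / 2 ^ K else 0)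
      has_integral (b - a) * (\<rho> ^ (2 * m) / 2 ^ K)) {0..1}"
    using ab by (subst has_integral_restrict) auto
  then have "(b - a) * (\<rho> ^ (2 * m) / 2 ^ K) \<le>
      (\<Sum>(as, ks, ls)\<in>?I. step_sign as * bch n (word (as, ks, ls)) * x ^ length (word (as, ks, ls)))"
    by (rule has_integral_le[OF _ h_int]) (use h_ge h_nonneg in auto)
  also have "\<dots> \<le> (\<Sum>i\<in>?I. \<bar>bch n (word i)\<bar> * x ^ length (word i))"
  proof (intro sum_mono, clarify)
    fix as ks ls
    have "step_sign as * bch n (word (as, ks, ls)) \<le> \<bar>bch n (word (as, ks, ls))\<bar>"
      using abs_ge_self[of "step_sign as * bch n (word (as, ks, ls))"]
      by (simp add: abs_mult abs_step_sign)
    then show "step_sign as * bch n (word (as, ks, ls)) * x ^ length (word (as, ks, ls)) \<le>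
        \<bar>bch n (word (as, ks, ls))\<bar> * x ^ length (word (as, ks, ls))"
      using x by (intro mult_right_mono) auto
  qed
  also have "\<dots> = (\<Sum>w\<in>word ` ?I. \<bar>bch n w\<bar> * x ^ length w)"
    by (simp add: sum.reindex[OF inj])
  finally have "ennreal ((b - a) * \<rho> ^ (2 * m) / 2 ^ K) \<le>
      ennreal (\<Sum>w\<in>word ` ?I. \<bar>bch n w\<bar> * x ^ length w)"
    by (intro ennreal_leI) simp
  also have "\<dots> \<le> Gamma_real (replicate n x)"
  proof (rule Gamma_real_replicate_ge[OF x])
    show "word ` ?I \<subseteq> lists {..<n}"
      using set_run_word by (force simp: word_def adj_words_def)
  qed (simp add: finI)
  finally show ?thesis .
qed

text \<open>With \<open>a\<close>, \<open>b\<close> and \<open>K\<close> fixed, only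
  \<open>\<rho> ^ (2 * m)\<close> varies in the lower bound, and it is unbounded.\<close>

lemma Gamma_real_eq_top:
  assumes "x \<ge> 0" "0 \<le> a" "a < b" "b \<le> 1" "\<rho> > 1"
    and "\<And>t. t \<in> {a..b} \<Longrightarrow>
      \<rho> \<le> real (n - 1) * sqrt (t * (1 - t)) * (\<Sum>k\<in>{1..K}. \<bar>run_coeff t k\<bar> * x ^ k)"
  shows "Gamma_real (replicate n x) = \<infinity>"
proof -
  have "ennreal r \<le> Gamma_real (replicate n x)" if "r \<ge> 0" for r :: real
  proof -
    define c where "c = (b - a) / 2 ^ K"
    have c: "c > 0" using assms by (simp add: c_def)
    obtain m where m: "r / c < \<rho> ^ m" using real_arch_pow[OF \<open>\<rho> > 1\<close>] by blast
    \<comment> \<open>\<open>Suc m\<close> appears because the lower bound requires a positive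
      number of runs in each half.\<close>
    have "\<rho> ^ m \<le> \<rho> ^ (2 * Suc m)" using \<open>\<rho> > 1\<close> by (intro power_increasing) auto
    then have "r / c \<le> \<rho> ^ (2 * Suc m)" using m by linarith
    then have "r \<le> (b - a) * \<rho> ^ (2 * Suc m) / 2 ^ K"
      using c by (simp add: c_def field_simps)
    then have "ennreal r \<le> ennreal ((b - a) * \<rho> ^ (2 * Suc m) / 2 ^ K)" by (rule ennreal_leI)
    also have "\<dots> \<le> Gamma_real (replicate n x)"
      using assms by (intro Gamma_real_ge_power) auto
    finally show ?thesis .
  qed
  note ge = this
  show ?thesis
  proof (cases "Gamma_real (replicate n x)")
    case (real r)
    then show ?thesis using ge[of "r + 1"] by simp
  qed simp
qed

section \<open>The generating function of the run coefficients\<close>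

text \<open>Extends the recursion to a Cauchy product over the full index range; the fractions are
  the coefficients of e^z - 1.\<close>

lemma run_coeff_eq:
  "run_coeff t k = (if k = 0 then 0 else 1) / fact k -
    t * (\<Sum>j\<le>k. (if j = 0 then 0 else 1) / fact j * run_coeff t (k - j))"
proof -
  have "(\<Sum>j\<le>k. (if j = 0 then 0 else 1) / fact j * run_coeff t (k - j)) =
      (\<Sum>j\<in>{1..<k}. run_coeff t (k - j) / fact j)"
    by (intro sum.mono_neutral_cong_right) (auto simp: run_coeff.simps[of t 0])
  then show ?thesis by (subst run_coeff.simps) simp
qed

text \<open>Absolute convergence permits the Cauchy product with the series of e^z - 1, and the
  recursion sums to H = (e^z - 1) - t (e^z - 1) H. The multiplied-out form avoids dividing by a
  possible zero.\<close>

lemma run_coeff_series: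
  fixes z :: complex
  assumes "summable (\<lambda>k. \<bar>run_coeff t k\<bar> * norm z ^ k)"
  shows "(\<Sum>k. of_real (run_coeff t k) * z ^ k) * (1 + of_real t * (exp z - 1)) = exp z - 1"
proof -
  define e where "e = (\<lambda>k. (if k = 0 then 0 else z ^ k /\<^sub>R fact k))"
  define H where "H = (\<Sum>k. of_real (run_coeff t k) * z ^ k)"
  have sH: "summable (\<lambda>k. norm (of_real (run_coeff t k) * z ^ k))"
    using assms by (simp add: norm_mult norm_power)
  have e: "e sums (exp z - 1)"
  proof -
    have "(\<lambda>k. z ^ k /\<^sub>R fact k - (if k = 0 then 1 else 0)) sums (exp z - 1)"
      using sums_diff[OF exp_converges[of z] sums_single[of 0 "\<lambda>_. 1"]] by simp
    moreover have "(\<lambda>k. z ^ k /\<^sub>R fact k - (if k = 0 then 1 else 0)) = e"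
      by (auto simp: e_def)
    ultimately show ?thesis by simp
  qed
  have se: "summable (\<lambda>k. norm (e k))"
    by (rule summable_comparison_test'[OF summable_norm_exp[of z], of 0]) (simp add: e_def)
  have "(\<lambda>k. e k - of_real t * (\<Sum>i\<le>k. e i * (of_real (run_coeff t (k - i)) * z ^ (k - i))))
      sums (exp z - 1 - of_real t * ((exp z - 1) * H))"
    using sums_diff[OF e sums_mult[OF Cauchy_product_sums[OF se sH]]] sums_unique[OF e]
    by (simp add: H_def)
  moreover have "e k - of_real t * (\<Sum>i\<le>k. e i * (of_real (run_coeff t (k - i)) * z ^ (k - i))) =
      of_real (run_coeff t k) * z ^ k" for k
  proof -
    have "(\<Sum>i\<le>k. e i * (of_real (run_coeff t (k - i)) * z ^ (k - i))) =
        (\<Sum>j\<le>k. of_real ((if j = 0 then 0 else 1) / fact j * run_coeff t (k - j)) * z ^ k)"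
      by (intro sum.cong) (auto simp: e_def scaleR_conv_of_real divide_inverse simp flip: power_add)
    also have "\<dots> = of_real (\<Sum>j\<le>k. (if j = 0 then 0 else 1) / fact j * run_coeff t (k - j)) * z ^ k"
      by (simp only: of_real_sum sum_distrib_right)
    finally show ?thesis
      by (subst (2) run_coeff_eq)
        (simp add: e_def scaleR_conv_of_real divide_inverse algebra_simps del: of_real_sum)
  qed
  ultimately have "H = exp z - 1 - of_real t * ((exp z - 1) * H)"
    unfolding H_def by (simp add: sums_iff)
  then show ?thesis unfolding H_def[symmetric] by (simp add: algebra_simps)
qed

text \<open>
  At an imaginary argument the odd and even parts of the series are its imaginary and real parts,
  so their sum bounds the series of absolute values from below.
\<close>

lemma Re_add_Im_imaginary_power_le: "Re (of_real c * (\<i> * of_real x) ^ k) +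
    Im (of_real c * (\<i> * of_real x) ^ k) \<le> \<bar>c\<bar> * \<bar>x\<bar> ^ k"
proof -
  have "Re (\<i> ^ k) + Im (\<i> ^ k) \<in> {1, -1}"
    by (induction k rule: nat_induct2) auto
  moreover have "Re (of_real c * (\<i> * of_real x) ^ k) + Im (of_real c * (\<i> * of_real x) ^ k) =
      c * x ^ k * (Re (\<i> ^ k) + Im (\<i> ^ k))"
    by (simp add: power_mult_distrib algebra_simps flip: of_real_power of_real_mult)
  moreover have "\<bar>c * x ^ k\<bar> = \<bar>c\<bar> * \<bar>x\<bar> ^ k" by (simp add: abs_mult power_abs)
  ultimately show ?thesis by auto
qed

text \<open>Since 1 + iT has argument arctan T, its quotient by its conjugate is
  \<open>cis (2 * arctan T)\<close>.\<close>

lemma cis_double_arctan: "cis (2 * arctan T) * (1 - \<i> * of_real T) = 1 + \<i> * of_real T"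
proof -
  let ?c = "complex_of_real (cos (arctan T))" and ?T = "complex_of_real T"
  have "cis (arctan T) = ?c * (1 + \<i> * ?T)"
    using tan_arctan[of T] by (simp add: complex_eq_iff tan_def divide_eq_eq mult.commute)
  moreover have "cis (2 * arctan T) = cis (arctan T) * cis (arctan T)"
    unfolding cis_mult by simp
  ultimately have "cis (2 * arctan T) = ?c * (1 + \<i> * ?T) * (?c * (1 + \<i> * ?T))"
    by (simp only:)
  then have "cis (2 * arctan T) * (1 - \<i> * ?T) = ?c\<^sup>2 * (1 + ?T\<^sup>2) * (1 + \<i> * ?T)"
    by (simp only:) (simp add: algebra_simps power2_eq_square)
  moreover have "(cos (arctan T))\<^sup>2 * (1 + T\<^sup>2) = 1"
    by (simp add: cos_arctan power_divide add_nonneg_eq_0_iff)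
  then have "?c\<^sup>2 * (1 + ?T\<^sup>2) = 1"
    by (metis of_real_1 of_real_add of_real_mult of_real_power)
  ultimately show ?thesis by simp
qed

text \<open>At z = ix one has e^z - 1 = 2iT / (1 - iT), and with t = (1 + v) / 2 the generating
  function becomes 2iT / (1 + ivT). The lower bound is the sum of its real and imaginary
  parts.\<close>

lemma run_coeff_abs_sum_ge:
  fixes v T :: real
  defines "t \<equiv> (1 + v) / 2" and "x \<equiv> 2 * arctan T"
  assumes "T \<ge> 0" "summable (\<lambda>k. \<bar>run_coeff t k\<bar> * x ^ k)"
  shows "2 * T * (1 + v * T) / (1 + v\<^sup>2 * T\<^sup>2) \<le> (\<Sum>k. \<bar>run_coeff t k\<bar> * x ^ k)"
proof -
  let ?z = "\<i> * of_real x" and ?a = "\<lambda>k. of_real (run_coeff t k) * (\<i> * of_real x) ^ k"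
  define H where "H = (\<Sum>k. ?a k)"
  have x: "x \<ge> 0" using assms by simp
  have s: "summable (\<lambda>k. \<bar>run_coeff t k\<bar> * norm ?z ^ k)" using assms(4) x by (simp add: norm_mult)
  then have sa: "summable ?a"
    by (intro summable_norm_cancel[of ?a]) (simp add: norm_mult norm_power)
  let ?T = "complex_of_real T" and ?v = "complex_of_real v"
  have "exp ?z = cis (2 * arctan T)" by (simp add: cis_conv_exp x_def)
  then have E: "exp ?z * (1 - \<i> * ?T) = 1 + \<i> * ?T" using cis_double_arctan by simp
  have "H * (1 + of_real t * (exp ?z - 1)) * (1 - \<i> * ?T) = (exp ?z - 1) * (1 - \<i> * ?T)"
    unfolding H_def run_coeff_series[OF s] ..
  moreover have "(exp ?z - 1) * (1 - \<i> * ?T) = 2 * \<i> * ?T" using E by (simp add: algebra_simps)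
  moreover have "(1 + of_real t * (exp ?z - 1)) * (1 - \<i> * ?T) = 1 + \<i> * ?v * ?T"
    unfolding distrib_right mult.assoc \<open>(exp ?z - 1) * (1 - \<i> * ?T) = 2 * \<i> * ?T\<close>
    by (simp add: t_def field_simps)
  ultimately have eq: "H * (1 + \<i> * ?v * ?T) = 2 * \<i> * ?T" by (simp add: mult.assoc)
  have pos: "1 + v\<^sup>2 * T\<^sup>2 > 0" by (simp add: add_pos_nonneg)
  have "H * (1 + \<i> * ?v * ?T) * (1 - \<i> * ?v * ?T) = H * of_real (1 + v\<^sup>2 * T\<^sup>2)"
    by (simp add: algebra_simps power2_eq_square)
  then have "H * of_real (1 + v\<^sup>2 * T\<^sup>2) = 2 * \<i> * ?T * (1 - \<i> * ?v * ?T)" unfolding eq by simp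
  from arg_cong[OF this, of Re] arg_cong[OF this, of Im]
  have "Re H * (1 + v\<^sup>2 * T\<^sup>2) = 2 * v * T\<^sup>2" "Im H * (1 + v\<^sup>2 * T\<^sup>2) = 2 * T"
    by (simp_all add: power2_eq_square algebra_simps)
  then have "2 * T * (1 + v * T) / (1 + v\<^sup>2 * T\<^sup>2) = Re H + Im H"
    using pos by (simp add: divide_eq_eq) (simp add: algebra_simps power2_eq_square)
  also have "\<dots> = (\<Sum>k. Re (?a k) + Im (?a k))"
    unfolding H_def Re_suminf[OF sa] Im_suminf[OF sa]
    by (rule suminf_add[OF summable_Re[OF sa] summable_Im[OF sa]])
  also have "\<dots> \<le> (\<Sum>k. \<bar>run_coeff t k\<bar> * x ^ k)"
  proof (rule suminf_le)
    show "Re (?a k) + Im (?a k) \<le> \<bar>run_coeff t k\<bar> * x ^ k" for k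
      using Re_add_Im_imaginary_power_le[of "run_coeff t k" x k] x by simp
    show "summable (\<lambda>k. Re (?a k) + Im (?a k))"
      using sa by (intro summable_add summable_Re summable_Im)
  qed (rule assms(4))
  finally show ?thesis .
qed

text \<open>The gain \<open>v * T\<close> is of first order in \<open>v\<close>, whereas the square
  root and the denominator cost only second order.\<close>

lemma sqrt_factor_ge:
  fixes T :: real
  assumes "0 < T" "T \<le> 1"
  defines "v \<equiv> T / 4"
  shows "sqrt (1 - v\<^sup>2) * ((1 + v * T) / (1 + v\<^sup>2 * T\<^sup>2)) > 1"
proof -
  have v: "0 < v" "v < 1" using assms by (auto simp: v_def)
  have "1 + v\<^sup>2 * T\<^sup>2 < (1 - v\<^sup>2) * (1 + v * T)"
  proof -
    have "T\<^sup>2 \<le> 1" using assms by (simp add: power_le_one)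
    then have "v * T\<^sup>2 + v\<^sup>2 * T \<le> v * 1 + v * 1 * 1"
      unfolding power2_eq_square[of v]
      using v assms by (intro add_mono mult_mono mult_left_mono) auto
    \<comment> \<open>The left-hand side is at most \<open>3 * v\<close>, that is 3T/4; hence the
      divisor 4 in \<open>v\<close>.\<close>
    then have "v + v * T\<^sup>2 + v\<^sup>2 * T < T" using assms unfolding v_def by linarith
    then have "v * (v + v * T\<^sup>2 + v\<^sup>2 * T) < v * T" using v by simp
    then show ?thesis by (simp add: algebra_simps power2_eq_square)
  qed
  moreover have "1 - v\<^sup>2 \<le> sqrt (1 - v\<^sup>2)"
  proof (rule real_le_rsqrt)
    have "0 \<le> v\<^sup>2" "v\<^sup>2 \<le> 1" using v by (auto simp: power_le_one)
    then show "(1 - v\<^sup>2)\<^sup>2 \<le> 1 - v\<^sup>2"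
      using mult_left_mono[of "1 - v\<^sup>2" 1 "1 - v\<^sup>2"] by (simp add: power2_eq_square)
  qed
  then have "(1 - v\<^sup>2) * (1 + v * T) \<le> sqrt (1 - v\<^sup>2) * (1 + v * T)"
    using v assms by (intro mult_right_mono) auto
  ultimately have "1 + v\<^sup>2 * T\<^sup>2 < sqrt (1 - v\<^sup>2) * (1 + v * T)" by linarith
  moreover have "1 + v\<^sup>2 * T\<^sup>2 > 0" by (simp add: add_pos_nonneg)
  ultimately show ?thesis by (simp add: less_divide_eq)
qed

lemma ex_run_coeff_sum_gt:
  fixes n :: nat
  assumes "n \<ge> 2"
  defines "T \<equiv> 1 / (real n - 1)"
  shows "\<exists>t K. 0 < t \<and> t < 1 \<and>
    real (n - 1) * sqrt (t * (1 - t)) * (\<Sum>k\<in>{1..K}. \<bar>run_coeff t k\<bar> * (2 * arctan T) ^ k) > 1"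
proof -
  define v where "v = T / 4" \<comment> \<open>any sufficiently small positive value works\<close>
  define t where "t = (1 + v) / 2"
  let ?x = "2 * arctan T"
  let ?f = "\<lambda>k. \<bar>run_coeff t k\<bar> * ?x ^ k"
  have T: "0 < T" "T \<le> 1" using assms by (auto simp: T_def divide_le_eq)
  then have x: "?x \<ge> 0" by simp
  have v: "0 < v" "v < 1" using T by (auto simp: v_def)
  then have t: "0 < t" "t < 1" by (auto simp: t_def)
  have tt: "sqrt (t * (1 - t)) = sqrt (1 - v\<^sup>2) / 2"
  proof -
    have "t * (1 - t) = (1 - v\<^sup>2) / 4" by (simp add: t_def field_simps power2_eq_square)
    then have "sqrt (t * (1 - t)) = sqrt (1 - v\<^sup>2) / sqrt 4" by (simp only: real_sqrt_divide)
    then show ?thesis by simp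
  qed
  have nT: "real (n - 1) = 1 / T" using assms by (simp add: T_def of_nat_diff)
  define c where "c = real (n - 1) * sqrt (t * (1 - t))"
  have c: "c > 0" using t assms by (simp add: c_def)
  \<comment> \<open>Otherwise the partial sums are bounded by \<open>1 / c\<close>, so the series
    converges and the closed-form lower bound applies to it; but that bound exceeds
    \<open>1 / c\<close>.\<close>
  have "\<exists>K. c * (\<Sum>k\<in>{1..K}. ?f k) > 1"
  proof (rule ccontr)
    assume "\<not> ?thesis"
    then have le: "(\<Sum>k\<in>{1..K}. ?f k) \<le> 1 / c" for K
      using c by (auto simp: field_simps not_less)
    have le': "(\<Sum>k<K. ?f k) \<le> 1 / c" for K
    proof -
      have "(\<Sum>k<K. ?f k) \<le> (\<Sum>k\<in>insert 0 {1..K}. ?f k)"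
        using x by (intro sum_mono2) auto
      also have "\<dots> = (\<Sum>k\<in>{1..K}. ?f k)" by (simp add: run_coeff.simps)
      finally show ?thesis using le[of K] by linarith
    qed
    have s: "summable ?f" using x le' by (intro summableI_nonneg_bounded[of ?f "1 / c"]) auto
    have "2 * T * (1 + v * T) / (1 + v\<^sup>2 * T\<^sup>2) \<le> suminf ?f"
      using run_coeff_abs_sum_ge[of T v] T s by (simp add: t_def)
    also have "\<dots> \<le> 1 / c" using s le' by (rule suminf_le_const)
    finally have "c * (2 * T * (1 + v * T) / (1 + v\<^sup>2 * T\<^sup>2)) \<le> 1"
      using c by (simp add: pos_le_divide_eq mult.commute)
    moreover have "c * (2 * T * (1 + v * T) / (1 + v\<^sup>2 * T\<^sup>2)) =
        sqrt (1 - v\<^sup>2) * ((1 + v * T) / (1 + v\<^sup>2 * T\<^sup>2))"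
      using T unfolding c_def tt nT by simp
    ultimately show False using sqrt_factor_ge[OF T, folded v_def] by linarith
  qed
  then show ?thesis using t unfolding c_def by blast
qed

theorem theorem3p20:
  fixes n :: nat
  assumes "n \<ge> 2"
  shows "\<exists>\<epsilon>::real. \<epsilon> > 0 \<and>
    Gamma_real (replicate n (1 / (1 + \<epsilon>) * (2 * arctan (1 / (real n - 1))))) = \<infinity>"
proof -
  define x where "x = (\<lambda>\<epsilon>. 1 / (1 + \<epsilon>) * (2 * arctan (1 / (real n - 1))))"
  define F where "F = (\<lambda>K t x. real (n - 1) * sqrt (t * (1 - t)) *
    (\<Sum>k\<in>{1..K}. \<bar>run_coeff t k\<bar> * x ^ k))"
  obtain t K where t: "0 < t" "t < 1" and gt: "F K t (x 0) > 1"
    using ex_run_coeff_sum_gt[OF assms] unfolding F_def x_def by auto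
  \<comment> \<open>For fixed \<open>t\<close> and \<open>K\<close> the sum is finite, so the strict
    inequality at \<epsilon> = 0 persists for small positive \<epsilon>.\<close>
  have "isCont (\<lambda>\<epsilon>. F K t (x \<epsilon>)) 0"
    unfolding F_def x_def by (intro continuous_intros) auto
  then have "((\<lambda>\<epsilon>. F K t (x \<epsilon>)) \<longlongrightarrow> F K t (x 0)) (at_right 0)"
    by (simp add: isCont_def filterlim_at_split)
  then have "\<forall>\<^sub>F \<epsilon> in at_right 0. F K t (x \<epsilon>) > 1 \<and> \<epsilon> > 0"
    using gt eventually_at_right_less[of 0] by (auto intro: eventually_conj order_tendstoD(1))
  then obtain \<epsilon> where \<epsilon>: "F K t (x \<epsilon>) > 1" "\<epsilon> > 0"
    using eventually_happens'[OF trivial_limit_at_right_real] by blast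
  \<comment> \<open>\<open>\<rho>\<close> leaves room between 1 and the value at \<open>t\<close>,
    so continuity in \<open>t\<close> yields a uniform bound on an interval to the right of
    \<open>t\<close>.\<close>
  obtain \<rho> where \<rho>: "1 < \<rho>" "\<rho> < F K t (x \<epsilon>)" using dense[OF \<epsilon>(1)] by blast
  have "continuous_on UNIV (\<lambda>t. F K t (x \<epsilon>))"
    unfolding F_def by (intro continuous_intros)
  then have "isCont (\<lambda>t. F K t (x \<epsilon>)) t" by (simp add: continuous_on_eq_continuous_at)
  then have "((\<lambda>t. F K t (x \<epsilon>)) \<longlongrightarrow> F K t (x \<epsilon>)) (at_right t)"
    by (simp add: isCont_def filterlim_at_split)
  then have "\<forall>\<^sub>F s in at_right t. \<rho> < F K s (x \<epsilon>)" using \<rho>(2) by (rule order_tendstoD(1))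
  then obtain c where c: "c > t" "\<And>s. t < s \<Longrightarrow> s < c \<Longrightarrow> \<rho> < F K s (x \<epsilon>)"
    unfolding eventually_at_right_field by blast
  obtain b where b: "t < b" "b < min c 1" using dense[of t "min c 1"] c t by auto
  have "Gamma_real (replicate n (x \<epsilon>)) = \<infinity>"
  proof (rule Gamma_real_eq_top[of _ t b \<rho>])
    show "x \<epsilon> \<ge> 0" using \<epsilon>(2) assms by (simp add: x_def)
    show "\<rho> \<le> real (n - 1) * sqrt (s * (1 - s)) * (\<Sum>k\<in>{1..K}. \<bar>run_coeff s k\<bar> * x \<epsilon> ^ k)"
      if "s \<in> {t..b}" for s
      \<comment> \<open>The right neighbourhood omits \<open>t\<close> itself, where the choice of
        \<open>\<rho>\<close> gives the bound.\<close>
      using c(2)[of s] \<rho>(2) that b unfolding F_def[symmetric] by (cases "s = t") (auto simp: F_def)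
  qed (use t b \<rho> in auto)
  then show ?thesis using \<epsilon>(2) unfolding x_def by blast
qed

end
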